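(* For $\xi\in(0,+\infty)$, $$t'(\xi)=\frac{q(\xi)}{\frac{\partial P}{\partial t}(t(\xi),q(\xi))}.$$
   Context: $D=\{(t,q)\in\mathbb{R}^2:2t-q>1\}$, $D_0=\{(t,q)\in\mathbb{R}^2:2t-q>1,\ 0\le t\le1\}$. Write $[\omega_1,\dots,\omega_n+x]=\cfrac{1}{\omega_1+\cfrac{1}{\ddots+\cfrac{1}{\omega_n+x}}}$. For $(t,q)\in D$, $$P(t,q)=\lim_{n\to\infty}\frac1n\log\sum_{\omega_1=1}^\infty\cdots\sum_{\omega_n=1}^\infty\exp\Big(\sup_{x\in[0,1]}\log\prod_{j=1}^n\omega_j^q\,([\omega_j,\dots,\omega_n+x])^{2t}\Big),$$ a real-analytic function on $D$. For $\xi>0$, $(t(\xi),q(\xi))\in D_0$ is the unique solution in $D_0$ of the system $P(t,q)=q\xi$, $\frac{\partial P}{\partial q}(t,q)=\xi$; the functions $t(\xi),q(\xi)$ are analytic on $(0,\infty)$. *)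

theory Defs
  imports "HOL-Analysis.Analysis"
begin

definition domD :: "(real \<times> real) set" where
  "domD = {(t, q). 2 * t - q > 1}"

definition domD0 :: "(real \<times> real) set" where
  "domD0 = {(t, q). 2 * t - q > 1 \<and> 0 \<le> t \<and> t \<le> 1}"

text \<open>For a nonempty list, \<open>cfrac [w\<^sub>1, \<dots>, w\<^sub>n] x\<close> is the finite continued fraction
  \<open>[w\<^sub>1, \<dots>, w\<^sub>n + x]\<close>; the value \<open>x\<close> at the empty list only serves the recursion.\<close>

fun cfrac :: "nat list \<Rightarrow> real \<Rightarrow> real" where
  "cfrac [] x = x"
| "cfrac (w # ws) x = 1 / (real w + cfrac ws x)"

definition words :: "nat \<Rightarrow> nat list set" where
  "words n = {w. length w = n \<and> (\<forall>k \<in> set w. 1 \<le> k)}"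

text \<open>The \<open>n\<close>-fold series over \<open>\<omega>\<^sub>1, \<dots>, \<omega>\<^sub>n \<ge> 1\<close> has positive terms and is rendered as one unordered
  sum over words of length \<open>n\<close>. Words are indexed from 0, so \<open>drop j w\<close> is the tail
  \<open>\<omega>\<^bsub>j+1\<^esub>, \<dots>, \<omega>\<^sub>n\<close>.\<close>

definition partition_sum :: "nat \<Rightarrow> real \<Rightarrow> real \<Rightarrow> real" where
  "partition_sum n t q =
     (\<Sum>\<^sub>\<infinity>w\<in>words n. exp (SUP x\<in>{0..1}.
        ln (\<Prod>j<n. real (w ! j) powr q * cfrac (drop j w) x powr (2 * t))))"

definition pressure :: "real \<Rightarrow> real \<Rightarrow> real" where
  "pressure t q = lim (\<lambda>n. 1 / real n * ln (partition_sum n t q))"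

definition pressure_dt :: "real \<Rightarrow> real \<Rightarrow> real" where
  "pressure_dt t q = deriv (\<lambda>s. pressure s q) t"

definition pressure_dq :: "real \<Rightarrow> real \<Rightarrow> real" where
  "pressure_dq t q = deriv (\<lambda>s. pressure t s) q"

text \<open>Real analyticity in one and two real variables: local expansion in a convergent power series
  around every point. The library's \<open>analytic_on\<close> is the complex notion.\<close>

definition real_analytic_on :: "(real \<Rightarrow> real) \<Rightarrow> real set \<Rightarrow> bool" where
  "real_analytic_on f S \<longleftrightarrow>
     (\<forall>a\<in>S. \<exists>r>0. \<exists>c :: nat \<Rightarrow> real. \<forall>x. \<bar>x - a\<bar> < r \<longrightarrow>
        (\<lambda>n. c n * (x - a) ^ n) sums f x)"

definition real_analytic2_on :: "(real \<Rightarrow> real \<Rightarrow> real) \<Rightarrow> (real \<times> real) set \<Rightarrow> bool" where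
  "real_analytic2_on f S \<longleftrightarrow>
     (\<forall>(a, b)\<in>S. \<exists>r>0. \<exists>c :: nat \<Rightarrow> nat \<Rightarrow> real.
        \<forall>x y. \<bar>x - a\<bar> < r \<and> \<bar>y - b\<bar> < r \<longrightarrow>
          ((\<lambda>(i, j). c i j * (x - a) ^ i * (y - b) ^ j) has_sum f x y) UNIV)"

definition solves_system :: "real \<Rightarrow> real \<Rightarrow> real \<Rightarrow> bool" where
  "solves_system \<xi> t q \<longleftrightarrow> pressure t q = q * \<xi> \<and> pressure_dq t q = \<xi>"

end

theory Submission imports Defs begin

text \<open>Differentiating \<open>P (t \<xi>, q \<xi>) = q \<xi> \<cdot> \<xi>\<close> along the solution curve and cancelling the terms in
  \<open>q'\<close> by means of \<open>\<partial>P/\<partial>q = \<xi>\<close> leaves \<open>\<partial>P/\<partial>t \<cdot> t' = q\<close>. What remains is \<open>\<partial>P/\<partial>t \<noteq> 0\<close>. The partition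
  sums are submultiplicative in \<open>n\<close>, so the limit defining \<open>P\<close> exists for \<open>t \<ge> 0\<close>. The product of
  all tails of a continued fraction of length \<open>n\<close> is at most \<open>2\<close> to the power \<open>(1 - n) / 2\<close>, hence
  raising \<open>t\<close> to \<open>s\<close> shrinks the \<open>n\<close>-th partition sum by at least the factor \<open>2\<close> to the power
  \<open>(s - t) (1 - n)\<close>, which in the limit gives \<open>\<partial>P/\<partial>t \<le> - ln 2\<close>.\<close>

section \<open>Tools from analysis: subadditive sequences, unordered sums, real power series\<close>

text \<open>Fekete's argument: the limit is the infimum \<open>L\<close> of the quotients with
  \<open>n \<ge> 1\<close>, finite because of the linear lower bound. Division of \<open>n\<close>
  by an \<open>m\<close> with nearly optimal quotient, together with subadditivity, bounds every
  later quotient from above.\<close>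

lemma subadditive_quotient_convergent:
  fixes a :: "nat \<Rightarrow> real"
  assumes sub: "\<And>m n. a (m + n) \<le> a m + a n"
    and lower: "\<And>n. c * real n \<le> a n"
  shows "convergent (\<lambda>n. a n / real n)"
proof -
  define L where "L = (INF n\<in>{1..}. a n / real n)"
  have bdd: "bdd_below ((\<lambda>n. a n / real n) ` {1..})"
    by (rule bdd_belowI2[of _ c]) (use lower in \<open>auto simp: field_simps\<close>)
  have L_le: "L \<le> a n / real n" if "n \<ge> 1" for n
    unfolding L_def using bdd that by (intro cINF_lower) auto
  have mult: "a (k * m + r) \<le> real k * a m + a r" for k m r
  proof (induction k)
    case (Suc k)
    have "a (Suc k * m + r) \<le> a m + a (k * m + r)"
      using sub[of m "k * m + r"] by (simp add: algebra_simps)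
    with Suc show ?case by (simp add: algebra_simps)
  qed simp
  have "(\<lambda>n. a n / real n) \<longlonglongrightarrow> L"
  proof (rule LIMSEQ_I)
    fix e :: real assume "e > 0"
    have "\<exists>m\<in>{1..}. a m / real m < L + e / 2"
      using \<open>e > 0\<close> bdd cINF_less_iff[of "{1::nat..}" "\<lambda>n. a n / real n" "L + e / 2"]
      unfolding L_def by auto
    then obtain m where m: "m \<ge> 1" "a m / real m < L + e / 2" by auto
    \<comment> \<open>\<open>B\<close> absorbs, uniformly in \<open>n\<close>, the two errors of
      division with remainder: the sum bounds \<open>a (n mod m)\<close>, and
      \<open>\<bar>a m\<bar>\<close> bounds the cost of replacing \<open>n div m\<close> by the
      exact quotient.\<close>
    define B where "B = (\<Sum>r<m. \<bar>a r\<bar>) + \<bar>a m\<bar>"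
    have bound: "a n \<le> real n * (a m / real m) + B" for n
    proof -
      have "a n \<le> real (n div m) * a m + a (n mod m)"
        using mult[of "n div m" m "n mod m"] by simp
      moreover have "real (n div m) * a m = real n * (a m / real m) - real (n mod m) / real m * a m"
      proof -
        have "real n = real (n div m) * real m + real (n mod m)"
          by (metis div_mult_mod_eq of_nat_add of_nat_mult)
        then show ?thesis using m by (simp add: field_simps)
      qed
      moreover have "\<bar>real (n mod m) / real m * a m\<bar> \<le> 1 * \<bar>a m\<bar>"
        unfolding abs_mult using m by (intro mult_right_mono) (auto intro: less_imp_le)
      moreover have "\<bar>a (n mod m)\<bar> \<le> (\<Sum>r<m. \<bar>a r\<bar>)"
        using m by (intro member_le_sum) auto
      ultimately show ?thesis unfolding B_def by linarith
    qed
    obtain N where N: "real N > 2 * B / e" using reals_Archimedean2 by blast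
    show "\<exists>N. \<forall>n\<ge>N. norm (a n / real n - L) < e"
    proof (intro exI allI impI)
      fix n assume n: "n \<ge> max 1 N"
      then have n0: "real n > 0" by simp
      have "real n \<ge> real N" using n by simp
      then have "2 * B / e < real n" using N by linarith
      then have "B / real n < e / 2" using n0 \<open>e > 0\<close> by (simp add: field_simps)
      moreover have "a n / real n \<le> a m / real m + B / real n"
        using bound[of n] n0 m by (simp add: field_simps)
      ultimately show "norm (a n / real n - L) < e"
        unfolding real_norm_def using m(2) L_le[of n] n by linarith
    qed
  qed
  then show ?thesis by (rule convergentI)
qed

lemma has_sum_nonneg_product:
  fixes f :: "'a \<Rightarrow> real" and g :: "'b \<Rightarrow> real"
  assumes "(f has_sum a) A" "(g has_sum b) B"
    and "\<And>x. x \<in> A \<Longrightarrow> f x \<ge> 0" "\<And>y. y \<in> B \<Longrightarrow> g y \<ge> 0"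
  shows "((\<lambda>(x, y). f x * g y) has_sum a * b) (A \<times> B)"
  by (rule has_sum_SigmaI[where g = "\<lambda>x. f x * b"])
     (use assms in \<open>auto intro!: has_sum_cmult_left has_sum_cmult_right summable_on_SigmaI
        simp: summable_on_cmult_left has_sum_imp_summable\<close>)

text \<open>The series is differentiated termwise in the centred variable at \<open>0\<close> and
  then translated; agreement with \<open>f\<close> within distance \<open>r\<close> of
  \<open>a\<close> transfers the derivative.\<close>

lemma real_analytic_on_imp_differentiable:
  assumes "real_analytic_on f S" "a \<in> S"
  shows "f differentiable (at a)"
proof -
  obtain r c where r: "r > 0" and
    c: "\<And>x. \<bar>x - a\<bar> < r \<Longrightarrow> (\<lambda>n. c n * (x - a) ^ n) sums f x"
    using assms unfolding real_analytic_on_def by blast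
  have "((\<lambda>z. \<Sum>n. c n * z ^ n) has_field_derivative (\<Sum>n. diffs c n * 0 ^ n)) (at 0)"
    by (rule termdiffs_strong'[where K = r]) (use r c[of "a + _"] in \<open>auto simp: sums_iff\<close>)
  then have "((\<lambda>x. \<Sum>n. c n * (x - a) ^ n) has_field_derivative (\<Sum>n. diffs c n * 0 ^ n)) (at a)"
    using DERIV_shift[of "\<lambda>x. \<Sum>n. c n * (x - a) ^ n" _ 0 a] by simp
  then have "(f has_field_derivative (\<Sum>n. diffs c n * 0 ^ n)) (at a)"
    by (rule has_field_derivative_transform_within[OF _ r])
       (use c in \<open>auto simp: sums_iff dist_real_def\<close>)
  then show ?thesis by (auto simp: real_differentiable_def)
qed

text \<open>The terms of total degree at least two are together quadratically small, so the linear
  terms form a Frechet derivative. Joint differentiability is what the chain rule along the solution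
  curve requires.\<close>

lemma real_analytic2_on_imp_has_derivative:
  assumes "real_analytic2_on f S" "(a, b) \<in> S"
  obtains u v where "((\<lambda>(x, y). f x y) has_derivative (\<lambda>(h, k). u * h + v * k)) (at (a, b))"
proof -
  obtain r c where r: "r > 0" and
    c: "\<And>x y. \<bar>x - a\<bar> < r \<Longrightarrow> \<bar>y - b\<bar> < r \<Longrightarrow>
          ((\<lambda>(i, j). c i j * (x - a) ^ i * (y - b) ^ j) has_sum f x y) UNIV"
    using assms unfolding real_analytic2_on_def by (fastforce split: prod.splits)
  \<comment> \<open>Any radius strictly below \<open>r\<close> would do: the corner
    \<open>(a + \<rho>, b + \<rho>)\<close> must lie in the region of convergence, since absolute
    summability there dominates all smaller increments.\<close>
  define \<rho> where "\<rho> = r / 2"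
  have \<rho>: "\<rho> > 0" "\<rho> < r" using r by (auto simp: \<rho>_def)
  \<comment> \<open>\<open>F\<close> holds the indices of total degree at most one; \<open>M\<close>
    is the absolute sum of all remaining terms at the corner.\<close>
  define F :: "(nat \<times> nat) set" where "F = {(0, 0), (1, 0), (0, 1)}"
  define M where "M = (\<Sum>\<^sub>\<infinity>(i, j)\<in>- F. \<bar>c i j\<bar> * \<rho> ^ (i + j))"
  have "(\<lambda>(i, j). c i j * \<rho> ^ i * \<rho> ^ j) summable_on UNIV"
    using has_sum_imp_summable[OF c[of "a + \<rho>" "b + \<rho>"]] \<rho> by simp
  then have "(\<lambda>p. norm (case p of (i, j) \<Rightarrow> c i j * \<rho> ^ i * \<rho> ^ j)) summable_on UNIV"
    using summable_on_iff_abs_summable_on_real by blast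
  moreover have "(\<lambda>p. norm (case p of (i, j) \<Rightarrow> c i j * \<rho> ^ i * \<rho> ^ j))
      = (\<lambda>(i, j). \<bar>c i j\<bar> * \<rho> ^ (i + j))"
    using \<rho> by (auto simp: abs_mult power_add fun_eq_iff)
  ultimately have "(\<lambda>(i, j). \<bar>c i j\<bar> * \<rho> ^ (i + j)) summable_on UNIV"
    by simp
  then have sM: "(\<lambda>(i, j). \<bar>c i j\<bar> * \<rho> ^ (i + j)) summable_on - F"
    using summable_on_subset_banach by blast
  have f00: "f a b = c 0 0"
  proof -
    have "((\<lambda>(i, j). c i j * 0 ^ i * 0 ^ j) has_sum c 0 0) {(0::nat, 0::nat)}"
      using has_sum_finite[of "{(0::nat, 0::nat)}" "\<lambda>(i, j). c i j * 0 ^ i * 0 ^ j"] by simp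
    then have "((\<lambda>(i, j). c i j * 0 ^ i * 0 ^ j) has_sum c 0 0) (UNIV :: (nat \<times> nat) set)"
      by (subst has_sum_cong_neutral[where T = "{(0::nat, 0::nat)}"
            and g = "\<lambda>(i, j). c i j * 0 ^ i * 0 ^ j"])
         (auto simp: power_0_left split: if_splits)
    with c[of a b] r show ?thesis using has_sum_unique by fastforce
  qed
  have key: "\<bar>f (a + h) (b + k) - f a b - (c 1 0 * h + c 0 1 * k)\<bar> \<le> M / \<rho>\<^sup>2 * m\<^sup>2"
    if m: "\<bar>h\<bar> \<le> m" "\<bar>k\<bar> \<le> m" "m \<le> \<rho>" for h k m
  proof -
    let ?g = "\<lambda>(i, j). c i j * h ^ i * k ^ j"
    have g: "(?g has_sum f (a + h) (b + k)) UNIV"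
      using c[of "a + h" "b + k"] that \<rho> by simp
    have "(?g has_sum (f (a + h) (b + k) - sum ?g F)) (UNIV - F)"
      by (rule has_sum_Diff[OF g has_sum_finite]) (auto simp: F_def)
    then have d: "(?g has_sum (f (a + h) (b + k) - f a b - (c 1 0 * h + c 0 1 * k))) (- F)"
      by (simp add: F_def f00 Compl_eq_Diff_UNIV algebra_simps)
    have le: "norm (?g p) \<le> (case p of (i, j) \<Rightarrow> \<bar>c i j\<bar> * \<rho> ^ (i + j)) * (m / \<rho>)\<^sup>2"
      if "p \<in> - F" for p
    proof -
      obtain i j where p: "p = (i, j)" by force
      have ij: "i + j \<ge> 2" using that unfolding p F_def by (cases i; cases j) auto
      have m0: "m \<ge> 0" using m by linarith
      have "\<bar>h ^ i * k ^ j\<bar> \<le> m ^ i * m ^ j"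
        unfolding abs_mult power_abs using m m0 by (intro mult_mono power_mono) auto
      also have "\<dots> = (m / \<rho>) ^ (i + j) * \<rho> ^ (i + j)"
        using \<rho> by (simp add: power_add power_divide)
      \<comment> \<open>Since \<open>m / \<rho> \<le> 1\<close>, lowering the exponent from
        \<open>i + j\<close> to \<open>2\<close> can only enlarge the power.\<close>
      also have "\<dots> \<le> (m / \<rho>)\<^sup>2 * \<rho> ^ (i + j)"
        using ij m m0 \<rho> by (intro mult_right_mono power_decreasing) auto
      finally have "\<bar>c i j\<bar> * \<bar>h ^ i * k ^ j\<bar> \<le> \<bar>c i j\<bar> * ((m / \<rho>)\<^sup>2 * \<rho> ^ (i + j))"
        by (rule mult_left_mono) simp
      then show ?thesis by (simp add: p abs_mult mult_ac)
    qed
    have "((\<lambda>p. (case p of (i, j) \<Rightarrow> \<bar>c i j\<bar> * \<rho> ^ (i + j)) * (m / \<rho>)\<^sup>2) has_sum M * (m / \<rho>)\<^sup>2) (- F)"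
      unfolding M_def by (intro has_sum_cmult_left has_sum_infsum sM)
    then have "norm (f (a + h) (b + k) - f a b - (c 1 0 * h + c 0 1 * k)) \<le> M * (m / \<rho>)\<^sup>2"
      using norm_infsum_le[OF d] le by blast
    then show ?thesis by (simp add: power_divide)
  qed
  have "((\<lambda>(x, y). f x y) has_derivative (\<lambda>(h, k). c 1 0 * h + c 0 1 * k)) (at (a, b))"
  proof (rule has_derivativeI_sandwich[OF \<rho>(1), where H = "\<lambda>p. M / \<rho>\<^sup>2 * norm (p - (a, b))"])
    show "bounded_linear (\<lambda>(h, k). c 1 0 * h + c 0 1 * k)"
      unfolding case_prod_beta by (intro bounded_linear_intros)
    fix p assume p: "p \<noteq> (a, b)" "dist p (a, b) < \<rho>"
    obtain x y where xy: "p = (x, y)" by force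
    define m where "m = norm (p - (a, b))"
    have m: "m > 0" "m < \<rho>" using p by (auto simp: m_def dist_norm)
    have "\<bar>x - a\<bar> \<le> m" "\<bar>y - b\<bar> \<le> m"
      unfolding m_def xy using norm_fst_le[of "x - a" "y - b"] norm_snd_le[of "y - b" "x - a"] by auto
    then have "\<bar>f x y - f a b - (c 1 0 * (x - a) + c 0 1 * (y - b))\<bar> \<le> M / \<rho>\<^sup>2 * m\<^sup>2"
      using key[of "x - a" m "y - b"] m by simp
    then show "norm ((case p of (x, y) \<Rightarrow> f x y) - (case (a, b) of (x, y) \<Rightarrow> f x y)
        - (case p - (a, b) of (h, k) \<Rightarrow> c 1 0 * h + c 0 1 * k)) / norm (p - (a, b))
      \<le> M / \<rho>\<^sup>2 * norm (p - (a, b))"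
      unfolding m_def[symmetric] using m by (simp add: xy divide_le_eq power2_eq_square mult.assoc)
  next
    have "((\<lambda>p. M / \<rho>\<^sup>2 * norm (p - (a, b))) \<longlongrightarrow> M / \<rho>\<^sup>2 * norm ((a, b) - (a, b))) (at (a, b))"
      by (intro tendsto_intros)
    then show "((\<lambda>p. M / \<rho>\<^sup>2 * norm (p - (a, b))) \<longlongrightarrow> 0) (at (a, b))" by simp
  qed
  then show thesis by (rule that)
qed

section \<open>Weights of words and their suprema\<close>

text \<open>Running the product up to \<open>length w\<close> makes it depend on the word alone,
  which opens it to induction on \<open>w\<close>.\<close>

definition weight :: "real \<Rightarrow> real \<Rightarrow> nat list \<Rightarrow> real \<Rightarrow> real" where
  "weight t q w x = (\<Prod>j<length w. real (w ! j) powr q * cfrac (drop j w) x powr (2 * t))"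

definition sup_weight :: "real \<Rightarrow> real \<Rightarrow> nat list \<Rightarrow> real" where
  "sup_weight t q w = exp (SUP x\<in>{0..1}. ln (weight t q w x))"

lemma partition_sum_eq: "partition_sum n t q = infsum (sup_weight t q) (words n)"
  unfolding partition_sum_def by (rule infsum_cong) (auto simp: words_def sup_weight_def weight_def)

lemma weight_Nil [simp]: "weight t q [] x = 1"
  by (simp add: weight_def)

lemma weight_Cons [simp]:
  "weight t q (k # w) x = real k powr q * cfrac (k # w) x powr (2 * t) * weight t q w x"
  by (simp add: weight_def prod.lessThan_Suc_shift del: prod.lessThan_Suc)

lemma cfrac_bounds:
  assumes "\<forall>k\<in>set w. 1 \<le> k" "0 \<le> x" "x \<le> 1"
  shows "0 \<le> cfrac w x" "cfrac w x \<le> 1"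
  using assms by (induction w) (auto simp: divide_simps)

text \<open>Strict positivity requires a nonempty word, as \<open>cfrac [] 0 = 0\<close>.\<close>

lemma cfrac_Cons_pos:
  assumes "1 \<le> k" "\<forall>k\<in>set w. 1 \<le> k" "0 \<le> x" "x \<le> 1"
  shows "0 < cfrac (k # w) x"
  using cfrac_bounds[of w x] assms by (auto intro!: divide_pos_pos add_pos_nonneg)

lemma cfrac_append: "cfrac (u @ v) x = cfrac u (cfrac v x)"
  by (induction u) auto

lemma weight_pos:
  assumes "\<forall>k\<in>set w. 1 \<le> k" "0 \<le> x" "x \<le> 1"
  shows "0 < weight t q w x"
  using assms
proof (induction w)
  case (Cons k w)
  then show ?case using cfrac_Cons_pos[of k w x] by (auto simp del: cfrac.simps)
qed simp

text \<open>A cocycle identity: the tails that start inside \<open>u\<close> see the value of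
  \<open>v\<close> as their end point, while those inside \<open>v\<close> are unchanged.\<close>

lemma weight_append: "weight t q (u @ v) x = weight t q u (cfrac v x) * weight t q v x"
  by (induction u) (auto simp: cfrac_append)

text \<open>A tail with leading digit \<open>k\<close> is at most \<open>1 / k\<close>. The bound is
  uniform in \<open>x\<close>; it makes the suprema finite and yields summability over one-letter
  words.\<close>

lemma weight_le:
  assumes "\<forall>k\<in>set w. 1 \<le> k" "0 \<le> x" "x \<le> 1" "0 \<le> t"
  shows "weight t q w x \<le> (\<Prod>k\<leftarrow>w. real k powr (q - 2 * t))"
  using assms
proof (induction w)
  case (Cons k w)
  have "cfrac (k # w) x \<le> 1 / real k"
    using cfrac_bounds[of w x] Cons.prems by (auto simp: divide_simps)
  then have "cfrac (k # w) x powr (2 * t) \<le> (1 / real k) powr (2 * t)"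
    using cfrac_Cons_pos[of k w x] Cons.prems by (intro powr_mono2) auto
  then have "real k powr q * cfrac (k # w) x powr (2 * t) \<le> real k powr q * (1 / real k) powr (2 * t)"
    by (rule mult_left_mono) simp
  also have "\<dots> = real k powr (q - 2 * t)"
    using Cons.prems by (simp add: powr_divide powr_diff)
  finally show ?case
    using Cons weight_pos[of w x t q] by (auto intro!: mult_mono simp del: cfrac.simps)
qed simp

text \<open>A real \<open>SUP\<close> is an upper bound only over a set bounded above, which
  \<open>weight_le\<close> guarantees for \<open>t \<ge> 0\<close>.\<close>

lemma weight_le_sup_weight:
  assumes "\<forall>k\<in>set w. 1 \<le> k" "0 \<le> x" "x \<le> 1" "0 \<le> t"
  shows "weight t q w x \<le> sup_weight t q w"
proof -
  have "bdd_above ((\<lambda>x. ln (weight t q w x)) ` {0..1})"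
    by (rule bdd_aboveI2[of _ _ "ln (\<Prod>k\<leftarrow>w. real k powr (q - 2 * t))"])
       (use assms weight_le weight_pos in \<open>auto intro!: ln_mono\<close>)
  then have "ln (weight t q w x) \<le> (SUP x\<in>{0..1}. ln (weight t q w x))"
    using assms by (intro cSUP_upper) auto
  then show ?thesis
    unfolding sup_weight_def using weight_pos[OF assms(1-3), of t q] by (metis exp_le_cancel_iff exp_ln)
qed

lemma sup_weight_leI:
  assumes "\<And>x. 0 \<le> x \<Longrightarrow> x \<le> 1 \<Longrightarrow> weight t q w x \<le> C" "\<forall>k\<in>set w. 1 \<le> k"
  shows "sup_weight t q w \<le> C"
proof -
  have C: "C > 0" using assms(1)[of 0] weight_pos[of w 0 t q] assms(2) by auto
  have "(SUP x\<in>{0..1}. ln (weight t q w x)) \<le> ln C"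
    by (rule cSUP_least) (use assms weight_pos C in auto)
  then have "exp (SUP x\<in>{0..1}. ln (weight t q w x)) \<le> exp (ln C)" by simp
  then show ?thesis using C by (simp add: sup_weight_def)
qed

lemma sup_weight_pos [simp]: "0 < sup_weight t q w"
  by (simp add: sup_weight_def)

text \<open>In \<open>weight_append\<close> the end point \<open>cfrac v x\<close> lies again in the
  unit interval, so each factor is bounded by its own supremum.\<close>

lemma sup_weight_append_le:
  assumes "\<forall>k\<in>set u. 1 \<le> k" "\<forall>k\<in>set v. 1 \<le> k" "0 \<le> t"
  shows "sup_weight t q (u @ v) \<le> sup_weight t q u * sup_weight t q v"
proof (rule sup_weight_leI)
  fix x :: real assume x: "0 \<le> x" "x \<le> 1"
  show "weight t q (u @ v) x \<le> sup_weight t q u * sup_weight t q v"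
    unfolding weight_append
    by (intro mult_mono weight_le_sup_weight cfrac_bounds)
       (use assms x weight_pos in \<open>auto intro: less_imp_le\<close>)
qed (use assms in auto)

section \<open>Partition sums: summability, submultiplicativity, lower bound\<close>

lemma bij_betw_append_words:
  "bij_betw (\<lambda>(u, v). u @ v) (words m \<times> words n) (words (m + n))"
  by (rule bij_betwI[where g = "\<lambda>w. (take m w, drop m w)"])
     (auto simp: words_def dest: in_set_takeD in_set_dropD)

text \<open>Unique splitting turns the sum over long words into a sum over pairs, dominated termwise
  by the product series. Summability is needed alongside the inequality because
  \<open>infsum\<close> defaults to \<open>0\<close> on families that are not summable.\<close>

lemma sup_weight_words_add:
  assumes "0 \<le> t" "sup_weight t q summable_on words m" "sup_weight t q summable_on words n"
  shows "sup_weight t q summable_on words (m + n)"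
    and "partition_sum (m + n) t q \<le> partition_sum m t q * partition_sum n t q"
proof -
  have prod: "((\<lambda>(u, v). sup_weight t q u * sup_weight t q v) has_sum
      partition_sum m t q * partition_sum n t q) (words m \<times> words n)"
    unfolding partition_sum_eq
    by (intro has_sum_nonneg_product has_sum_infsum assms) (auto intro: less_imp_le)
  have le: "sup_weight t q (case p of (u, v) \<Rightarrow> u @ v)
      \<le> (case p of (u, v) \<Rightarrow> sup_weight t q u * sup_weight t q v)" if "p \<in> words m \<times> words n" for p
    using that assms(1) by (auto simp: words_def intro!: sup_weight_append_le)
  have s: "(\<lambda>p. sup_weight t q (case p of (u, v) \<Rightarrow> u @ v)) summable_on (words m \<times> words n)"
    by (rule summable_on_comparison_test[OF has_sum_imp_summable[OF prod]])
       (use le in \<open>auto intro: less_imp_le\<close>)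
  then show "sup_weight t q summable_on words (m + n)"
    using summable_on_reindex_bij_betw[OF bij_betw_append_words] by blast
  have "partition_sum (m + n) t q
      = infsum (\<lambda>p. sup_weight t q (case p of (u, v) \<Rightarrow> u @ v)) (words m \<times> words n)"
    unfolding partition_sum_eq using infsum_reindex_bij_betw[OF bij_betw_append_words] by metis
  also have "\<dots> \<le> partition_sum m t q * partition_sum n t q"
    using has_sum_mono[OF has_sum_infsum[OF s] prod] le by blast
  finally show "partition_sum (m + n) t q \<le> partition_sum m t q * partition_sum n t q" .
qed

text \<open>Induction on the length reduces to one letter, where the series is dominated by that of
  the zeta function at \<open>2 * t - q > 1\<close>.\<close>

lemma sup_weight_summable_words:
  assumes "0 \<le> t" "2 * t - q > 1"
  shows "sup_weight t q summable_on words n"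
proof (induction n)
  case 0
  have "words 0 = {[]}" by (auto simp: words_def)
  then show ?case by simp
next
  case (Suc n)
  have bij: "bij_betw (\<lambda>k. [k]) {1..} (words 1)"
    by (rule bij_betwI[where g = hd]) (auto simp: words_def length_Suc_conv)
  have "(\<lambda>k. real k powr (q - 2 * t)) summable_on UNIV"
    using assms by (intro summable_nonneg_imp_summable_on) (auto simp: summable_real_powr_iff)
  then have "(\<lambda>k. real k powr (q - 2 * t)) summable_on {1..}"
    using summable_on_subset_banach by blast
  then have "(\<lambda>k. sup_weight t q [k]) summable_on {1..}"
  proof (rule summable_on_comparison_test)
    fix k :: nat assume "k \<in> {1..}"
    then show "sup_weight t q [k] \<le> real k powr (q - 2 * t)"
      using weight_le[of "[k]" _ t q] assms by (intro sup_weight_leI) auto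
  qed (auto intro: less_imp_le)
  then have "sup_weight t q summable_on words 1"
    using summable_on_reindex_bij_betw[OF bij] by blast
  then show ?case using sup_weight_words_add(1)[OF assms(1) _ Suc, of 1] by simp
qed

text \<open>For the digit \<open>1\<close> the factor with exponent \<open>q\<close> is
  \<open>1\<close>, and every tail is \<open>1 / (1 + y)\<close> with \<open>y \<le> 1\<close>. This
  single word gives the linear lower bound on the logarithms of the partition sums.\<close>

lemma weight_replicate_one_ge:
  assumes "0 \<le> t"
  shows "(1 / 2) powr (2 * t * real n) \<le> weight t q (replicate n 1) 0"
proof (induction n)
  case (Suc n)
  have "cfrac (replicate (Suc n) 1) 0 \<ge> 1 / 2"
    using cfrac_bounds[of "replicate n 1" 0] by (auto simp: divide_simps)
  then have "(1 / 2) powr (2 * t) \<le> cfrac (replicate (Suc n) 1) 0 powr (2 * t)"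
    using assms by (intro powr_mono2) auto
  then have "(1 / 2) powr (2 * t) * (1 / 2) powr (2 * t * real n)
      \<le> cfrac (replicate (Suc n) 1) 0 powr (2 * t) * weight t q (replicate n 1) 0"
    using Suc by (intro mult_mono) auto
  then show ?case by (simp add: powr_add[symmetric] algebra_simps)
qed simp

lemma partition_sum_ge:
  assumes "0 \<le> t" "2 * t - q > 1"
  shows "(1 / 2) powr (2 * t * real n) \<le> partition_sum n t q"
proof -
  have "(1 / 2) powr (2 * t * real n) \<le> sup_weight t q (replicate n 1)"
    using weight_replicate_one_ge[OF assms(1), of n q]
      weight_le_sup_weight[of "replicate n 1" 0 t q] assms by auto
  also have "\<dots> = sum (sup_weight t q) {replicate n 1}" by simp
  also have "\<dots> \<le> partition_sum n t q"
    unfolding partition_sum_eq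
    by (rule finite_sum_le_infsum[OF sup_weight_summable_words[OF assms]])
       (auto simp: words_def intro: less_imp_le)
  finally show ?thesis .
qed

lemma partition_sum_pos:
  assumes "0 \<le> t" "2 * t - q > 1"
  shows "0 < partition_sum n t q"
  using partition_sum_ge[OF assms, of n] by (rule less_le_trans[rotated]) simp

section \<open>The pressure: existence of the limit and decrease in \<open>t\<close>\<close>

text \<open>\<open>lim\<close> is informative only for convergent sequences. The logarithm turns
  submultiplicativity into subadditivity, and the word of ones supplies the constant
  \<open>2 * t * ln (1 / 2)\<close> of the linear lower bound.\<close>

lemma pressure_LIMSEQ:
  assumes "0 \<le> t" "2 * t - q > 1"
  shows "(\<lambda>n. ln (partition_sum n t q) / real n) \<longlonglongrightarrow> pressure t q"
proof -
  have "convergent (\<lambda>n. ln (partition_sum n t q) / real n)"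
  proof (rule subadditive_quotient_convergent)
    fix m n
    show "ln (partition_sum (m + n) t q) \<le> ln (partition_sum m t q) + ln (partition_sum n t q)"
      using sup_weight_words_add(2)[OF assms(1) sup_weight_summable_words[OF assms]
          sup_weight_summable_words[OF assms], of m n]
        partition_sum_pos[OF assms] by (simp add: ln_mult_pos[symmetric])
    show "2 * t * ln (1 / 2) * real n \<le> ln (partition_sum n t q)"
      using ln_mono[OF partition_sum_ge[OF assms, of n]] partition_sum_pos[OF assms, of n]
      by (simp add: ln_powr mult_ac)
  qed
  then show ?thesis
    unfolding pressure_def by (simp add: convergent_LIMSEQ_iff)
qed

text \<open>This isolates the effect of changing \<open>t\<close>: with \<open>q = 0\<close> the
  digit factors are \<open>1\<close>, so the second weight is the product of all tails to the power
  \<open>2 * (s - t)\<close>.\<close>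

lemma weight_diff:
  assumes "\<forall>k\<in>set w. 1 \<le> k" "0 \<le> x" "x \<le> 1"
  shows "weight s q w x = weight t q w x * weight (s - t) 0 w x"
  using assms
proof (induction w)
  case (Cons k w)
  have "2 * s = 2 * t + 2 * (s - t)" by simp
  then have "cfrac (k # w) x powr (2 * s) = cfrac (k # w) x powr (2 * t) * cfrac (k # w) x powr (2 * (s - t))"
    by (metis powr_add)
  with Cons show ?case by (simp del: cfrac.simps)
qed simp

text \<open>For \<open>y \<le> 1 \<le> k\<close> one has \<open>y \<cdot> 1 / (k + y) \<le> 1 / 2\<close>, so any two consecutive tails of the
  continued fraction contribute a factor at most \<open>1 / 2\<close>.\<close>

lemma weight_zero_le:
  assumes "\<forall>k\<in>set w. 1 \<le> k" "0 \<le> x" "x \<le> 1" "0 \<le> d"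
  shows "weight d 0 w x \<le> 2 powr (d * (1 - real (length w)))"
  using assms
proof (induction w rule: induct_list012)
  case 1
  then show ?case by (simp add: ge_one_powr_ge_zero)
next
  case (2 k)
  then show ?case using cfrac_bounds[of "[k]" x] by (simp add: powr_le1 del: cfrac.simps)
next
  case (3 k l w)
  define y where "y = cfrac (l # w) x"
  have y: "0 < y" "y \<le> 1"
    using cfrac_Cons_pos[of l w x] cfrac_bounds[of "l # w" x] 3 by (auto simp: y_def simp del: cfrac.simps)
  have c: "cfrac (k # l # w) x = 1 / (real k + y)" by (simp add: y_def)
  have "y / (real k + y) \<le> 1 / 2" using y 3 by (simp add: divide_simps)
  then have "(y / (real k + y)) powr (2 * d) \<le> (1 / 2) powr (2 * d)"
    using y 3 by (intro powr_mono2) auto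
  also have "(y / (real k + y)) powr (2 * d) = (1 / (real k + y)) powr (2 * d) * y powr (2 * d)"
    using y by (subst powr_mult[symmetric]) auto
  also have "(1 / 2 :: real) powr (2 * d) = 2 powr (- 2 * d)"
    by (simp add: powr_divide powr_minus divide_simps)
  finally have "(1 / (real k + y)) powr (2 * d) * y powr (2 * d) * weight d 0 w x
      \<le> 2 powr (- 2 * d) * 2 powr (d * (1 - real (length w)))"
    using 3 weight_pos[of w x d 0] by (intro mult_mono) auto
  then show ?case using 3
    by (simp add: c y_def[symmetric] powr_add[symmetric] algebra_simps del: cfrac.simps)
qed

text \<open>The bound of \<open>weight_zero_le\<close> depends only on the length of the word, so it
  passes through the supremum and the sum; after taking logarithms and dividing by \<open>n\<close>,
  its contribution tends to \<open>- (s - t) * ln 2\<close>.\<close>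

lemma pressure_decrease:
  assumes "0 \<le> t" "2 * t - q > 1" "t \<le> s"
  shows "pressure s q \<le> pressure t q - (s - t) * ln 2"
proof -
  have s: "0 \<le> s" "2 * s - q > 1" using assms by auto
  have Z: "partition_sum n s q \<le> partition_sum n t q * 2 powr ((s - t) * (1 - real n))" for n
    unfolding partition_sum_eq infsum_cmult_left'[symmetric]
  proof (rule infsum_mono)
    fix w assume "w \<in> words n"
    then have w: "\<forall>k\<in>set w. 1 \<le> k" "length w = n" by (auto simp: words_def)
    show "sup_weight s q w \<le> sup_weight t q w * 2 powr ((s - t) * (1 - real n))"
    proof (rule sup_weight_leI[OF _ w(1)])
      fix x :: real assume x: "0 \<le> x" "x \<le> 1"
      show "weight s q w x \<le> sup_weight t q w * 2 powr ((s - t) * (1 - real n))"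
        unfolding weight_diff[OF w(1) x, of s q t]
        using weight_zero_le[OF w(1) x, of "s - t"] weight_le_sup_weight[OF w(1) x, of t q]
          weight_pos[OF w(1) x] assms w
        by (intro mult_mono) (auto intro: less_imp_le)
    qed
  qed (use sup_weight_summable_words s assms in \<open>auto intro!: summable_on_cmult_left\<close>)
  \<comment> \<open>The restriction to \<open>n \<ge> 1\<close> matters: division by zero gives
    \<open>0\<close>, so at \<open>n = 0\<close> the inequality would read
    \<open>0 \<le> - (s - t) * ln 2\<close>.\<close>
  have "ln (partition_sum n s q) / real n
      \<le> ln (partition_sum n t q) / real n + (s - t) * ln 2 * (1 / real n - 1)" if "n \<ge> 1" for n
  proof -
    have "ln (partition_sum n s q) \<le> ln (partition_sum n t q * 2 powr ((s - t) * (1 - real n)))"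
      using Z partition_sum_pos[OF s, of n] by (intro ln_mono) auto
    also have "\<dots> = ln (partition_sum n t q) + (s - t) * (1 - real n) * ln 2"
      using partition_sum_pos[OF assms(1,2), of n] by (simp add: ln_mult_pos ln_powr)
    finally show ?thesis using that by (simp add: field_simps)
  qed
  then have ev: "\<forall>\<^sub>F n in sequentially. ln (partition_sum n s q) / real n
      \<le> ln (partition_sum n t q) / real n + (s - t) * ln 2 * (1 / real n - 1)"
    using eventually_ge_at_top[of 1] by (rule eventually_mono[rotated])
  have "(\<lambda>n. ln (partition_sum n t q) / real n + (s - t) * ln 2 * (1 / real n - 1))
      \<longlonglongrightarrow> pressure t q + (s - t) * ln 2 * (0 - 1)"
    by (intro tendsto_intros pressure_LIMSEQ assms lim_1_over_n)
  from tendsto_le[OF _ this pressure_LIMSEQ[OF s] ev] show ?thesis by simp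
qed

section \<open>Implicit differentiation along the solution curve\<close>

text \<open>The conclusion includes that the denominator is nonzero, because a quotient by zero
  would silently be \<open>0\<close>.\<close>

theorem proposition4p15:
  fixes t q :: "real \<Rightarrow> real"
  assumes P_analytic: "real_analytic2_on pressure domD"
    and solution: "\<And>\<xi>. \<xi> > 0 \<Longrightarrow> (t \<xi>, q \<xi>) \<in> domD0 \<and> solves_system \<xi> (t \<xi>) (q \<xi>)"
    and unique: "\<And>\<xi> t' q'. \<xi> > 0 \<Longrightarrow> (t', q') \<in> domD0 \<Longrightarrow> solves_system \<xi> t' q' \<Longrightarrow>
                   t' = t \<xi> \<and> q' = q \<xi>"
    and t_analytic: "real_analytic_on t {0<..}"
    and q_analytic: "real_analytic_on q {0<..}"
  shows "\<forall>\<xi>>0. pressure_dt (t \<xi>) (q \<xi>) \<noteq> 0 \<and>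
           (t has_real_derivative q \<xi> / pressure_dt (t \<xi>) (q \<xi>)) (at \<xi>)"
proof (intro allI impI)
  fix \<xi> :: real assume \<xi>: "\<xi> > 0"
  have D: "0 \<le> t \<xi>" "2 * t \<xi> - q \<xi> > 1" and dq: "pressure_dq (t \<xi>) (q \<xi>) = \<xi>"
    using solution[OF \<xi>] by (auto simp: domD0_def solves_system_def)
  then have "(t \<xi>, q \<xi>) \<in> domD" by (simp add: domD_def)
  then obtain u v where uv:
    "((\<lambda>(x, y). pressure x y) has_derivative (\<lambda>(h, k). u * h + v * k)) (at (t \<xi>, q \<xi>))"
    using real_analytic2_on_imp_has_derivative[OF P_analytic] by blast
  \<comment> \<open>One chain rule for three curves: the two lines parallel to the axes identify
    \<open>u\<close> and \<open>v\<close> as the partial derivatives, and the solution curve gives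
    the equation for \<open>t'\<close>.\<close>
  have chain: "((\<lambda>z. pressure (f z) (g z)) has_real_derivative u * f' + v * g') (at z)"
    if "(f has_real_derivative f') (at z)" "(g has_real_derivative g') (at z)"
       "f z = t \<xi>" "g z = q \<xi>" for f g f' g' z
  proof -
    have "((\<lambda>z. (f z, g z)) has_derivative (\<lambda>h. (f' * h, g' * h))) (at z)"
      using that(1,2) by (auto simp: has_field_derivative_def intro!: has_derivative_Pair)
    then have "((\<lambda>z. pressure (f z) (g z)) has_derivative (\<lambda>h. u * (f' * h) + v * (g' * h))) (at z)"
      using has_derivative_compose[of "\<lambda>z. (f z, g z)" "\<lambda>h. (f' * h, g' * h)" z UNIV "\<lambda>(x, y). pressure x y"
          "\<lambda>(h, k). u * h + v * k"] uv that(3,4) by simp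
    then show ?thesis
      by (rule has_derivative_imp_has_field_derivative) (simp add: algebra_simps)
  qed
  have dt_deriv: "((\<lambda>s. pressure s (q \<xi>)) has_real_derivative u) (at (t \<xi>))"
    using chain[OF DERIV_ident DERIV_const] by simp
  then have u: "pressure_dt (t \<xi>) (q \<xi>) = u"
    unfolding pressure_dt_def by (rule DERIV_imp_deriv)
  have "((\<lambda>s. pressure (t \<xi>) s) has_real_derivative v) (at (q \<xi>))"
    using chain[OF DERIV_const DERIV_ident] by simp
  then have v: "v = \<xi>"
    using dq DERIV_imp_deriv unfolding pressure_dq_def by blast
  \<comment> \<open>Otherwise \<open>pressure s (q \<xi>) + s * ln 2\<close> would increase strictly
    just to the right of \<open>t \<xi>\<close>, against \<open>pressure_decrease\<close>. Looking
    only to the right keeps the first parameter nonnegative.\<close>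
  have "u \<le> - ln 2"
  proof (rule ccontr)
    assume "\<not> u \<le> - ln 2"
    then have "0 < u + ln 2" by simp
    moreover have "((\<lambda>s. pressure s (q \<xi>) + s * ln 2) has_real_derivative u + ln 2) (at (t \<xi>))"
      using DERIV_add[OF dt_deriv DERIV_cmult_right[OF DERIV_ident, of "ln 2"]] by simp
    ultimately obtain d where d: "d > 0" "\<And>h. 0 < h \<Longrightarrow> h < d \<Longrightarrow>
        pressure (t \<xi>) (q \<xi>) + t \<xi> * ln 2 < pressure (t \<xi> + h) (q \<xi>) + (t \<xi> + h) * ln 2"
      using DERIV_pos_inc_right by blast
    from d(2)[of "d / 2"] pressure_decrease[OF D, of "t \<xi> + d / 2"] \<open>d > 0\<close> show False
      by (simp add: algebra_simps)
  qed
  then have u0: "u \<noteq> 0" using ln_gt_zero[of 2] by auto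
  obtain t' where t': "(t has_real_derivative t') (at \<xi>)"
    using real_analytic_on_imp_differentiable[OF t_analytic] \<xi> by (auto simp: real_differentiable_def)
  obtain q' where q': "(q has_real_derivative q') (at \<xi>)"
    using real_analytic_on_imp_differentiable[OF q_analytic] \<xi> by (auto simp: real_differentiable_def)
  have "((\<lambda>z. pressure (t z) (q z)) has_real_derivative u * t' + v * q') (at \<xi>)"
    using chain[OF t' q'] by simp
  \<comment> \<open>The system holds at every positive \<open>z\<close>, hence at all
    \<open>z\<close> within distance \<open>\<xi>\<close> of \<open>\<xi>\<close>; there the
    composite may be replaced by \<open>q z * z\<close>.\<close>
  moreover have "((\<lambda>z. pressure (t z) (q z)) has_real_derivative q' * \<xi> + 1 * q \<xi>) (at \<xi>)"
    by (rule has_field_derivative_transform_within[OF DERIV_mult[OF q' DERIV_ident] \<xi>])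
       (use solution in \<open>auto simp: solves_system_def dist_real_def\<close>)
  ultimately have "u * t' + v * q' = q' * \<xi> + 1 * q \<xi>" by (rule DERIV_unique)
  then have "t' = q \<xi> / u" using u0 v by (simp add: field_simps)
  with t' u u0 show "pressure_dt (t \<xi>) (q \<xi>) \<noteq> 0 \<and>
      (t has_real_derivative q \<xi> / pressure_dt (t \<xi>) (q \<xi>)) (at \<xi>)" by simp
qed

end
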